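(* Let $d\ge2$, $1\le m\le d$, let $\omega:\{1,\dots,d\}\to\{1,\dots,m\}$ be an onto map, and let $\gamma$ be the curve defined on $I_\circ=[0,1]$ by $\gamma(s)=(s^{a_1},\dots,s^{a_d})$ for integers $1\le a_1<\dots<a_d$. Then there exists a Borel set $F'\subset\mathbb R^d\times(0,1)^m$ with $\dim_H F'=d+m-2$ such that $\Gamma^\omega(F')$ is of Lebesgue measure zero in $\mathbb R^d$.
   Context: $\dim_H$ denotes Hausdorff dimension. $I\subset\subset I_\circ$ is a fixed subinterval of positive length. For $\mathbf t=(t_1,\dots,t_m)$ and $\gamma=(\gamma_1,\dots,\gamma_d)$, $$\gamma^\omega_{\mathbf t}(s)=(t_{\omega(1)}\gamma_1(s),\dots,t_{\omega(d)}\gamma_d(s)),$$ and for $F'\subset\mathbb R^d\times(0,1)^m$, $$\Gamma^\omega(F')=\bigcup_{(x,\mathbf t)\in F'}\big(x+\gamma^\omega_{\mathbf t}(I)\big),\qquad \gamma^\omega_{\mathbf t}(I)=\{\gamma^\omega_{\mathbf t}(s):s\in I\}.$$ *)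

theory Defs
  imports "HOL-Analysis.Analysis"
begin

text \<open>
  The \<open>s\<close>-th power of the diameter of a bounded set, with the conventions under which the
  zero-dimensional Hausdorff measure is counting measure: the empty set contributes \<open>0\<close> and
  any other set contributes \<open>1\<close> when \<open>s = 0\<close>.  (Note that \<open>0 powr 0 = 0\<close> in this library.)
\<close>

definition diam_pow :: "real \<Rightarrow> 'a::metric_space set \<Rightarrow> ennreal" where
  "diam_pow s U =
     (if U = {} then 0 else if s = 0 then 1 else ennreal (diameter U powr s))"

text \<open>
  The covering sets are required to be bounded because the library's \<open>diameter\<close> is real-valued
  and carries no information on unbounded sets.  Finite covers are included, as the
  sets of the sequence may be empty.
\<close>

definition hausdorff_premeasure :: "real \<Rightarrow> real \<Rightarrow> 'a::metric_space set \<Rightarrow> ennreal" where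
  "hausdorff_premeasure s \<delta> A =
     (INF U \<in> {U :: nat \<Rightarrow> 'a set. A \<subseteq> (\<Union>i. U i) \<and> (\<forall>i. bounded (U i) \<and> diameter (U i) \<le> \<delta>)}.
        (\<Sum>i. diam_pow s (U i)))"

definition hausdorff_measure :: "real \<Rightarrow> 'a::metric_space set \<Rightarrow> ennreal" where
  "hausdorff_measure s A = (SUP \<delta> \<in> {0<..}. hausdorff_premeasure s \<delta> A)"

definition hausdorff_dim :: "'a::metric_space set \<Rightarrow> ereal" where
  "hausdorff_dim A = (INF s \<in> {s. 0 \<le> s \<and> hausdorff_measure s A = 0}. ereal s)"

definition dilated_curve ::
    "('d \<Rightarrow> 'm) \<Rightarrow> (real \<Rightarrow> real ^ 'd) \<Rightarrow> real ^ 'm \<Rightarrow> real \<Rightarrow> real ^ 'd" where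
  "dilated_curve \<omega> \<gamma> t s = (\<chi> i. t $ \<omega> i * \<gamma> s $ i)"

definition curve_union ::
    "('d \<Rightarrow> 'm) \<Rightarrow> (real \<Rightarrow> real ^ 'd) \<Rightarrow> real set
      \<Rightarrow> ((real ^ 'd) \<times> (real ^ 'm)) set \<Rightarrow> (real ^ 'd) set" where
  "curve_union \<omega> \<gamma> I F = (\<Union>(x, t)\<in>F. (\<lambda>y. x + y) ` dilated_curve \<omega> \<gamma> t ` I)"

definition open_unit_cube :: "(real ^ 'm) set" where
  "open_unit_cube = {t. \<forall>j. 0 < t $ j \<and> t $ j < 1}"

end

theory Submission
  imports Defs
begin

text \<open>
  If two coordinates \<open>i \<noteq> j\<close> carry independent dilations, rescaling the parameter \<open>s\<close> moves the arc
  along a fixed curve: with \<open>t\<^sub>i = r\<^bsup>a i\<^esup>\<close> and \<open>t\<^sub>j = r\<^bsup>a j\<^esup>\<close> the projection of the arc to the \<open>(i, j)\<close>-plane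
  lies on the curve \<open>y\<^sub>i = x\<^sub>i + q (y\<^sub>j - x\<^sub>j)\<close> for one function \<open>q\<close> which does not depend on \<open>r\<close>.  If
  \<open>i\<close> and \<open>j\<close> share a dilation, freezing it has the same effect.  So fix \<open>x\<^sub>j = 0\<close>, impose one equation
  on \<open>t\<close>, and restrict \<open>x\<^sub>i\<close> to a null set \<open>C\<close> of dimension one; all other coordinates stay free.
  These are \<open>d + m - 2\<close> dimensions of parameters, while the union of the curves lies in
  \<open>{y. y\<^sub>i - q y\<^sub>j \<in> C}\<close>, whose sections in direction \<open>i\<close> are translates of \<open>C\<close>.
\<close>

section \<open>Bounds on Hausdorff measure and dimension\<close>

text \<open>Mass distribution: a covering piece of diameter \<open>d\<close> pulls back under
  \<open>\<phi>\<close> to points whose \<open>B\<close>-coordinates vary by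
  O(\<open>d powr (1/p)\<close>), hence to volume O(\<open>d powr s\<close>) when
  \<open>p = card B / s\<close>. A cheap cover of \<open>A\<close> would thus cover the box with too
  little volume. Coordinates outside \<open>B\<close> only contribute a fixed factor, so
  \<open>\<phi>\<close> may ignore them.\<close>

lemma hausdorff_measure_pos:
  fixes \<phi> :: "'a::euclidean_space \<Rightarrow> 'b::metric_space" and s :: real
  assumes B: "B \<subseteq> Basis" "0 \<le> s" "s < card B"
    and box: "box a b \<noteq> {}"
    and \<phi>: "\<phi> ` cbox a b \<subseteq> A"
    and holder: "\<And>p. 1 < p \<Longrightarrow> \<exists>K>0. \<forall>u\<in>cbox a b. \<forall>v\<in>cbox a b. \<forall>c\<in>B.
                   \<bar>(u - v) \<bullet> c\<bar> powr p \<le> K * dist (\<phi> u) (\<phi> v)"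
  shows "hausdorff_measure s A \<noteq> 0"
proof
  assume 0: "hausdorff_measure s A = 0"
  have ab: "a \<bullet> c < b \<bullet> c" if "c \<in> Basis" for c
    using box that by (auto simp: box_ne_empty)
  define M where "M = (\<Prod>c\<in>Basis. (b - a) \<bullet> c)"
  have M: "emeasure lborel (cbox a b) = ennreal M" "0 < M"
    using ab by (auto simp: M_def less_imp_le inner_diff_left intro!: prod_pos)
  have "\<exists>K'>0. \<forall>U. bounded U \<longrightarrow>
          (\<exists>V\<in>sets lborel. {u\<in>cbox a b. \<phi> u \<in> U} \<subseteq> V \<and> emeasure lborel V \<le> ennreal K' * diam_pow s U)"
  proof (cases "s = 0")
    \<comment> \<open>Every nonempty piece now costs 1, so the whole box serves as
      \<open>V\<close>.\<close>
    case True
    have "\<exists>V\<in>sets lborel. {u\<in>cbox a b. \<phi> u \<in> U} \<subseteq> V \<and> emeasure lborel V \<le> ennreal M * diam_pow s U" for U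
    proof (cases "U = {}")
      case False
      then show ?thesis using True M by (intro bexI[of _ "cbox a b"]) (auto simp: diam_pow_def)
    qed (auto intro!: bexI[of _ "{}"])
    with M(2) show ?thesis by blast
  next
    case False
    define n where "n = card B"
    \<comment> \<open>Chosen so that \<open>r ^ n\<close> below becomes
      \<open>(K * d) powr s\<close>; it exceeds 1 because \<open>s < n\<close>.\<close>
    define p where "p = n / s"
    have s: "0 < s" using False B by simp
    have n: "0 < n" using B n_def s by simp
    have "1 < p" using B s by (simp add: p_def n_def field_simps)
    then obtain K where K: "K > 0" and
      KB: "\<And>u v c. u\<in>cbox a b \<Longrightarrow> v\<in>cbox a b \<Longrightarrow> c\<in>B \<Longrightarrow> \<bar>(u - v) \<bullet> c\<bar> powr p \<le> K * dist (\<phi> u) (\<phi> v)"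
      using holder[of p] by blast
    define W where "W = (\<Prod>c\<in>Basis - B. (b - a) \<bullet> c)"
    have W: "0 < W" using ab by (auto simp: W_def inner_diff_left intro!: prod_pos)
    define K' where "K' = 2^n * K powr s * W"
    have K': "0 < K'" using W K by (simp add: K'_def)
    have "\<exists>V\<in>sets lborel. {u\<in>cbox a b. \<phi> u \<in> U} \<subseteq> V \<and> emeasure lborel V \<le> ennreal K' * diam_pow s U"
      if U: "bounded U" for U
    proof (cases "\<exists>u0\<in>cbox a b. \<phi> u0 \<in> U")
      case True
      then obtain w where w: "w \<in> cbox a b" "\<phi> w \<in> U" by blast
      define d where "d = diameter U"
      have d: "0 \<le> d" unfolding d_def using U by (rule diameter_ge_0)
      define r where "r = (K * d) powr (1/p)"
      have r: "0 \<le> r" by (simp add: r_def)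
      define lo where "lo = (\<Sum>c\<in>Basis. (if c \<in> B then w \<bullet> c - r else a \<bullet> c) *\<^sub>R c)"
      define hi where "hi = (\<Sum>c\<in>Basis. (if c \<in> B then w \<bullet> c + r else b \<bullet> c) *\<^sub>R c)"
      have lo: "lo \<bullet> c = (if c \<in> B then w \<bullet> c - r else a \<bullet> c)" if "c \<in> Basis" for c
        using that by (simp add: lo_def)
      have hi: "hi \<bullet> c = (if c \<in> B then w \<bullet> c + r else b \<bullet> c)" if "c \<in> Basis" for c
        using that by (simp add: hi_def)
      have sub: "{u\<in>cbox a b. \<phi> u \<in> U} \<subseteq> cbox lo hi"
      proof
        fix u assume "u \<in> {u\<in>cbox a b. \<phi> u \<in> U}"
        then have u: "u \<in> cbox a b" "\<phi> u \<in> U" by auto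
        have "\<bar>u \<bullet> c - w \<bullet> c\<bar> \<le> r" if c: "c \<in> B" for c
        proof -
          have "\<bar>(u - w) \<bullet> c\<bar> powr p \<le> K * dist (\<phi> u) (\<phi> w)" by (rule KB[OF u(1) w(1) c])
          also have "\<dots> \<le> K * d" unfolding d_def
            using diameter_bounded_bound[OF U u(2) w(2)] K by simp
          finally have "(\<bar>(u - w) \<bullet> c\<bar> powr p) powr (1/p) \<le> r"
            unfolding r_def using \<open>1 < p\<close> by (intro powr_mono2) auto
          then show ?thesis using \<open>1 < p\<close> by (simp add: powr_powr inner_diff_left)
        qed
        then show "u \<in> cbox lo hi" using u(1) unfolding mem_box
          by (auto simp: lo hi abs_le_iff) (smt (verit))+
      qed
      have "emeasure lborel (cbox lo hi) = ennreal (\<Prod>c\<in>Basis. (hi - lo) \<bullet> c)"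
        using ab r by (intro emeasure_lborel_cbox) (auto simp: lo hi less_imp_le)
      also have "(\<Prod>c\<in>Basis. (hi - lo) \<bullet> c) = (\<Prod>c\<in>Basis - B. (hi - lo) \<bullet> c) * (\<Prod>c\<in>B. (hi - lo) \<bullet> c)"
        using B(1) by (intro prod.subset_diff) auto
      also have "(\<Prod>c\<in>Basis - B. (hi - lo) \<bullet> c) = W"
        unfolding W_def by (intro prod.cong) (auto simp: lo hi inner_diff_left)
      also have "(\<Prod>c\<in>B. (hi - lo) \<bullet> c) = (\<Prod>c\<in>B. 2 * r)"
        using B(1) by (intro prod.cong) (auto simp: lo hi inner_diff_left)
      also have "\<dots> = 2 ^ n * r ^ n" by (simp add: n_def power_mult_distrib)
      also have "r ^ n = (K * d) powr s"
        unfolding r_def using n s \<open>1 < p\<close> by (cases "K * d = 0") (auto simp: powr_power p_def)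
      also have "W * (2 ^ n * (K * d) powr s) = K' * d powr s"
        using K d by (simp add: K'_def powr_mult)
      also have "ennreal (K' * d powr s) = ennreal K' * diam_pow s U"
        using w False K' by (auto simp: diam_pow_def d_def ennreal_mult)
      finally show ?thesis using sub by (intro bexI[of _ "cbox lo hi"]) auto
    qed (auto intro!: bexI[of _ "{}"])
    with K' show ?thesis by blast
  qed
  then obtain K' where K': "0 < K'" and V:
    "\<And>U. bounded U \<Longrightarrow> \<exists>V\<in>sets lborel. {u\<in>cbox a b. \<phi> u \<in> U} \<subseteq> V \<and> emeasure lborel V \<le> ennreal K' * diam_pow s U"
    by blast
  \<comment> \<open>One scale suffices: the premeasure at scale 1 lies below the measure, and pieces
    costing less than \<open>M / K'\<close> in total cannot fill the volume
    \<open>M\<close>.\<close>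
  have "hausdorff_premeasure s 1 A \<le> hausdorff_measure s A"
    unfolding hausdorff_measure_def by (rule SUP_upper) simp
  then have "hausdorff_premeasure s 1 A < ennreal (M / K')"
    using 0 M K' by simp
  then obtain U :: "nat \<Rightarrow> 'b set" where U: "A \<subseteq> (\<Union>i. U i)" "\<And>i. bounded (U i)"
    and sm: "(\<Sum>i. diam_pow s (U i)) < ennreal (M / K')"
    unfolding hausdorff_premeasure_def by (auto simp: INF_less_iff)
  obtain V where V: "\<And>i. V i \<in> sets lborel" "\<And>i. {u\<in>cbox a b. \<phi> u \<in> U i} \<subseteq> V i"
    "\<And>i. emeasure lborel (V i) \<le> ennreal K' * diam_pow s (U i)"
    using V[OF U(2)] by metis
  have "cbox a b \<subseteq> (\<Union>i. V i)"
    using U(1) \<phi> V(2) by blast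
  then have "ennreal M \<le> emeasure lborel (\<Union>i. V i)"
    unfolding M(1)[symmetric] using V(1) by (intro emeasure_mono) auto
  also have "\<dots> \<le> (\<Sum>i. emeasure lborel (V i))"
    using V(1) by (intro emeasure_subadditive_countably) auto
  also have "\<dots> \<le> (\<Sum>i. ennreal K' * diam_pow s (U i))"
    by (intro suminf_le V(3)) auto
  also have "\<dots> = ennreal K' * (\<Sum>i. diam_pow s (U i))" by simp
  also have "\<dots> < ennreal K' * ennreal (M / K')"
    using sm K' by (intro ennreal_mult_strict_left_mono) auto
  also have "\<dots> = ennreal M" using K' M by (simp add: ennreal_mult[symmetric])
  finally show False by simp
qed

lemma hausdorff_premeasure_le_sum:
  fixes U :: "'i \<Rightarrow> 'a::metric_space set"
  assumes J: "finite J" and A: "A \<subseteq> (\<Union>f\<in>J. U f)" and "0 \<le> \<delta>"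
    and U: "\<And>f. f \<in> J \<Longrightarrow> bounded (U f) \<and> diameter (U f) \<le> \<delta>"
  shows "hausdorff_premeasure s \<delta> A \<le> (\<Sum>f\<in>J. diam_pow s (U f))"
proof -
  obtain e where e: "bij_betw e {0..<card J} J" using ex_bij_betw_nat_finite[OF J] by blast
  define V where "V k = (if k < card J then U (e k) else {})" for k
  have eJ: "e k \<in> J" if "k < card J" for k using e that by (auto simp: bij_betw_def)
  have cover: "A \<subseteq> (\<Union>k. V k)"
  proof
    fix x assume "x \<in> A"
    then obtain f where f: "f \<in> J" "x \<in> U f" using A by blast
    then obtain k where "k < card J" "f = e k" using e by (force simp: bij_betw_def)
    then have "x \<in> V k" using f by (simp add: V_def)
    then show "x \<in> (\<Union>k. V k)" by blast
  qed
  have "hausdorff_premeasure s \<delta> A \<le> (\<Sum>k. diam_pow s (V k))"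
    unfolding hausdorff_premeasure_def using cover U eJ \<open>0 \<le> \<delta>\<close>
    by (intro INF_lower) (auto simp: V_def diameter_empty)
  also have "\<dots> = (\<Sum>k\<in>{0..<card J}. diam_pow s (V k))"
    by (rule suminf_finite) (auto simp: V_def diam_pow_def)
  also have "\<dots> = (\<Sum>k\<in>{0..<card J}. diam_pow s (U (e k)))"
    by (intro sum.cong) (auto simp: V_def)
  also have "\<dots> = (\<Sum>f\<in>J. diam_pow s (U f))"
    by (rule sum.reindex_bij_betw[OF e])
  finally show ?thesis .
qed

text \<open>On \<open>A\<close> the \<open>B\<close>-coordinates control distances, so a grid of
  mesh \<open>R / N\<close> in these coordinates alone cuts \<open>A\<close> into
  \<open>(2 * N + 1) ^ card B\<close> pieces of diameter at most \<open>K * R / N\<close>. Their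
  total cost has order \<open>N powr (card B - s)\<close> and tends to 0.\<close>

lemma hausdorff_measure_eq_0:
  fixes A :: "'a::euclidean_space set" and s :: real
  assumes B: "B \<subseteq> Basis" "card B < s" and "bounded A" and K: "0 \<le> K"
    and ctrl: "\<And>u v r. u \<in> A \<Longrightarrow> v \<in> A \<Longrightarrow> 0 \<le> r \<Longrightarrow> (\<And>c. c \<in> B \<Longrightarrow> \<bar>(u - v) \<bullet> c\<bar> \<le> r)
                 \<Longrightarrow> dist u v \<le> K * r"
  shows "hausdorff_measure s A = 0"
proof -
  obtain R where R: "0 < R" and AR: "\<And>u. u \<in> A \<Longrightarrow> norm u \<le> R"
    using \<open>bounded A\<close> unfolding bounded_pos by blast
  define n where "n = card B"
  have s: "0 < s" using B by linarith
  have fB: "finite B" using B(1) finite_Basis finite_subset by blast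
  define L where "L = K * R"
  have L: "0 \<le> L" using K R by (simp add: L_def)
  have bound: "hausdorff_premeasure s \<delta> A \<le> ennreal (3 ^ n * L powr s * real N powr (n - s))"
    if N: "0 < N" "L / N \<le> \<delta>" for \<delta> and N :: nat
  proof -
    define h where "h = R / N"
    have h: "0 < h" using R N by (simp add: h_def)
    \<comment> \<open>Here \<open>R = N * h\<close>, and a coordinate equal to \<open>R\<close> has
      index \<open>N\<close>; hence \<open>2 * N + 1\<close> indices and not
      \<open>2 * N\<close>.\<close>
    define J where "J = PiE B (\<lambda>_. {- int N .. int N})"
    define U where "U f = {u \<in> A. \<forall>c\<in>B. \<lfloor>(u \<bullet> c) / h\<rfloor> = f c}" for f
    have fJ: "finite J" unfolding J_def using fB by (intro finite_PiE) auto
    have cJ: "card J = (2 * N + 1) ^ n"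
    proof -
      have "card {- int N .. int N} = 2 * N + 1" by simp
      then show ?thesis unfolding J_def using fB by (simp add: card_PiE n_def)
    qed
    have cov: "A \<subseteq> (\<Union>f\<in>J. U f)"
    proof
      fix u assume u: "u \<in> A"
      define f where "f = (\<lambda>c\<in>B. \<lfloor>(u \<bullet> c) / h\<rfloor>)"
      have "\<lfloor>(u \<bullet> c) / h\<rfloor> \<in> {- int N .. int N}" if c: "c \<in> B" for c
      proof -
        have "\<bar>u \<bullet> c\<bar> \<le> R" using Basis_le_norm[of c u] c B AR[OF u] by force
        then have "\<bar>u \<bullet> c / h\<bar> \<le> N" using h N R by (simp add: h_def abs_mult field_simps)
        then have "- real N \<le> u \<bullet> c / h" "u \<bullet> c / h \<le> real N" by linarith+
        then show ?thesis by (simp add: le_floor_iff floor_le_iff)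
      qed
      then have "f \<in> J" by (auto simp: f_def J_def)
      moreover have "u \<in> U f" using u by (auto simp: U_def f_def)
      ultimately show "u \<in> (\<Union>f\<in>J. U f)" by blast
    qed
    have dU: "dist u v \<le> L / N" if "u \<in> U f" "v \<in> U f" for u v f
    proof -
      have "\<bar>(u - v) \<bullet> c\<bar> \<le> h" if c: "c \<in> B" for c
      proof -
        have "\<lfloor>(u \<bullet> c) / h\<rfloor> = \<lfloor>(v \<bullet> c) / h\<rfloor>" using \<open>u \<in> U f\<close> \<open>v \<in> U f\<close> c by (simp add: U_def)
        then have "\<bar>(u \<bullet> c) / h - (v \<bullet> c) / h\<bar> \<le> 1" by linarith
        then show ?thesis using h by (simp add: diff_divide_distrib[symmetric] abs_div inner_diff_left field_simps)
      qed
      then have "dist u v \<le> K * h" using that h by (intro ctrl) (auto simp: U_def)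
      then show ?thesis by (simp add: L_def h_def)
    qed
    have bU: "bounded (U f)" for f
      using \<open>bounded A\<close> by (rule bounded_subset) (auto simp: U_def)
    have diamU: "diameter (U f) \<le> L / N" for f
      using dU L N by (intro diameter_le) (auto simp: dist_norm)
    have "hausdorff_premeasure s \<delta> A \<le> (\<Sum>f\<in>J. diam_pow s (U f))"
    proof (rule hausdorff_premeasure_le_sum[OF fJ cov])
      show "0 \<le> \<delta>" using N L by (meson divide_nonneg_nonneg of_nat_0_le_iff order_trans)
    qed (use bU diamU N(2) order_trans in blast)
    also have "\<dots> \<le> (\<Sum>f\<in>J. ennreal ((L / N) powr s))"
      unfolding diam_pow_def using s diamU bU
      by (intro sum_mono) (auto intro!: ennreal_leI powr_mono2 diameter_ge_0)
    also have "\<dots> = ennreal (card J * (L / N) powr s)"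
      by (simp add: ennreal_mult ennreal_of_nat_eq_real_of_nat)
    also have "\<dots> \<le> ennreal (3 ^ n * L powr s * real N powr (n - s))"
    proof (rule ennreal_leI)
      have "real (card J) \<le> (3 * real N) ^ n"
        unfolding cJ of_nat_power using N by (intro power_mono) auto
      also have "\<dots> = 3 ^ n * real N powr n" using N by (simp add: power_mult_distrib powr_realpow)
      finally have "card J * (L / N) powr s \<le> 3 ^ n * real N powr n * (L / N) powr s"
        by (intro mult_right_mono) auto
      also have "\<dots> = 3 ^ n * L powr s * real N powr (n - s)"
        using N L by (simp add: powr_divide powr_diff)
      finally show "card J * (L / N) powr s \<le> 3 ^ n * L powr s * real N powr (n - s)" .
    qed
    finally show ?thesis .
  qed
  have "hausdorff_premeasure s \<delta> A \<le> 0" if \<delta>: "0 < \<delta>" for \<delta>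
  \<comment> \<open>\<open>\<delta>\<close> stays fixed while \<open>N\<close> grows; the bound is
    available once \<open>L / N < \<delta>\<close>.\<close>
  proof (rule tendsto_lowerbound)
    have "(\<lambda>N. real N powr (n - s)) \<longlonglongrightarrow> 0"
      using B n_def by (intro tendsto_neg_powr filterlim_real_sequentially) auto
    then have "(\<lambda>N. 3 ^ n * L powr s * real N powr (n - s)) \<longlonglongrightarrow> 3 ^ n * L powr s * 0"
      by (intro tendsto_intros)
    then show "(\<lambda>N. ennreal (3 ^ n * L powr s * real N powr (n - s))) \<longlonglongrightarrow> 0"
      by (metis ennreal_0 mult_zero_right tendsto_ennrealI)
    have "(\<lambda>N. L / real N) \<longlonglongrightarrow> 0" by (rule lim_const_over_n)
    then have "\<forall>\<^sub>F N in sequentially. L / real N < \<delta>" using \<delta> by (rule order_tendstoD)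
    then show "\<forall>\<^sub>F N in sequentially. hausdorff_premeasure s \<delta> A \<le> ennreal (3 ^ n * L powr s * real N powr (n - s))"
      using eventually_gt_at_top[of 0] by eventually_elim (simp add: bound)
  qed simp
  then show ?thesis unfolding hausdorff_measure_def
    by (metis (no_types, lifting) SUP_least greaterThan_iff le_zero_eq)
qed

lemma hausdorff_dim_eqI:
  assumes "0 \<le> n" and "\<And>s. n < s \<Longrightarrow> hausdorff_measure s A = 0"
    and "\<And>s. 0 \<le> s \<Longrightarrow> s < n \<Longrightarrow> hausdorff_measure s A \<noteq> 0"
  shows "hausdorff_dim A = ereal n"
proof (rule antisym)
  show "hausdorff_dim A \<le> ereal n"
  proof (rule ereal_le_epsilon2)
    fix e :: real assume "0 < e"
    then show "hausdorff_dim A \<le> ereal n + ereal e"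
      unfolding hausdorff_dim_def using assms(1) assms(2)[of "n + e"]
      by (intro INF_lower2[of "n + e"]) auto
  qed
  show "ereal n \<le> hausdorff_dim A"
    unfolding hausdorff_dim_def using assms(3) by (intro INF_greatest) (force simp: not_less[symmetric])
qed

section \<open>A null set of Hausdorff dimension one\<close>

text \<open>
  The function \<open>cantor_param\<close> jumps by at least \<open>cantor_coeff k\<close> at every dyadic rational of level \<open>k\<close>.
  The factor \<open>2\<^bsup>-k\<^esup>\<close> makes the inverse Hoelder continuous of every exponent below one, and the summable
  factor \<open>(k + 1)\<^bsup>-2\<^esup>\<close> makes the jumps exhaust the increments, so that the range is null.
\<close>

definition cantor_coeff :: "nat \<Rightarrow> real" where
  "cantor_coeff k = 1 / (2 ^ k * (real k + 1)\<^sup>2)"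

definition cantor_param :: "real \<Rightarrow> real" where
  "cantor_param y = (\<Sum>k. cantor_coeff k * of_int \<lfloor>2 ^ k * y\<rfloor>)"

lemma cantor_coeff_pos: "0 < cantor_coeff k"
  by (simp add: cantor_coeff_def)

lemma summable_inverse_square_Suc: "summable (\<lambda>k. 1 / (real k + 1)\<^sup>2)"
  using summable_Suc_iff[of "\<lambda>n. 1 / (real n)\<^sup>2"] inverse_power_summable[of 2]
  by (simp add: field_simps)

lemma cantor_param_summable:
  fixes y :: real
  assumes "0 \<le> y" "y \<le> 1"
  shows "summable (\<lambda>k. cantor_coeff k * of_int \<lfloor>2 ^ k * y\<rfloor>)"
proof (rule summable_comparison_test'[OF summable_inverse_square_Suc, of 0])
  fix k :: nat
  have "of_int \<lfloor>2 ^ k * y\<rfloor> \<le> (2::real) ^ k"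
  proof -
    have "2 ^ k * y \<le> 2 ^ k" using assms by simp
    then show ?thesis using of_int_floor_le[of "2 ^ k * y"] by linarith
  qed
  moreover have "0 \<le> real_of_int \<lfloor>2 ^ k * y\<rfloor>" using assms by simp
  ultimately show "norm (cantor_coeff k * of_int \<lfloor>2 ^ k * y\<rfloor>) \<le> 1 / (real k + 1)\<^sup>2"
    by (simp add: cantor_coeff_def field_simps)
qed

lemma cantor_param_diff:
  assumes "x \<in> {0..1}" "y \<in> {0..1}"
  shows "(\<lambda>k. cantor_coeff k * (of_int \<lfloor>2 ^ k * y\<rfloor> - of_int \<lfloor>2 ^ k * x\<rfloor>)) sums (cantor_param y - cantor_param x)"
  unfolding cantor_param_def right_diff_distrib
  using assms by (intro sums_diff summable_sums cantor_param_summable) auto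

text \<open>Points at least \<open>1 / 2 ^ k\<close> apart have different floors at level
  \<open>k\<close>, and no level contributes negatively, so this one term gives the bound.\<close>

lemma cantor_param_expand:
  assumes "0 \<le> x" "y \<le> 1" "1 / 2 ^ k \<le> y - x"
  shows "cantor_coeff k \<le> cantor_param y - cantor_param x"
proof -
  have xy: "x \<le> y" using assms(3) by (smt (verit) divide_nonneg_nonneg zero_le_power)
  have mono: "\<lfloor>2 ^ n * x\<rfloor> \<le> \<lfloor>2 ^ n * y\<rfloor>" for n :: nat
    using xy by (intro floor_mono mult_left_mono) auto
  have "2 ^ k * x + 1 \<le> 2 ^ k * y" using assms(3) by (simp add: field_simps)
  then have "\<lfloor>2 ^ k * x\<rfloor> + 1 \<le> \<lfloor>2 ^ k * y\<rfloor>" by linarith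
  then have 1: "1 \<le> real_of_int \<lfloor>2 ^ k * y\<rfloor> - of_int \<lfloor>2 ^ k * x\<rfloor>" by linarith
  have s: "(\<lambda>k. cantor_coeff k * (of_int \<lfloor>2 ^ k * y\<rfloor> - of_int \<lfloor>2 ^ k * x\<rfloor>)) sums (cantor_param y - cantor_param x)"
    using assms xy by (intro cantor_param_diff) auto
  have "cantor_coeff k \<le> (\<Sum>n\<in>{k}. cantor_coeff n * (of_int \<lfloor>2 ^ n * y\<rfloor> - of_int \<lfloor>2 ^ n * x\<rfloor>))"
    using 1 cantor_coeff_pos[of k] by simp
  also have "\<dots> \<le> cantor_param y - cantor_param x"
    unfolding sums_unique[OF s]
    using mono cantor_coeff_pos by (intro sum_le_suminf sums_summable[OF s]) (auto simp: less_imp_le)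
  finally show ?thesis .
qed

text \<open>At the first \<open>k\<close> with \<open>1 / 2 ^ k \<le> y - x\<close>, the distance is
  at most \<open>2 / 2 ^ k\<close> while \<open>cantor_param\<close> grows by at least
  \<open>cantor_coeff k\<close>. Up to a constant the quotient is
  \<open>(k + 1)^2 * 2 powr (- (p - 1) * k)\<close>, which is bounded since
  \<open>p > 1\<close>.\<close>

lemma cantor_param_holder:
  assumes p: "1 < p"
  shows "\<exists>K>0. \<forall>x\<in>{0..1}. \<forall>y\<in>{0..1}. \<bar>x - y\<bar> powr p \<le> K * \<bar>cantor_param x - cantor_param y\<bar>"
proof -
  \<comment> \<open>Writing the sequence as a square reduces its limit to those of
    \<open>k * c ^ k\<close> and \<open>c ^ k\<close> with
    \<open>c = 2 powr (- (p - 1) / 2) < 1\<close>.\<close>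
  have eq: "((real k + 1) * (2 powr (- (p - 1) / 2)) ^ k)\<^sup>2 = (real k + 1)\<^sup>2 * 2 powr (- (p - 1) * k)" for k
    by (simp add: power_mult_distrib powr_power mult.commute flip: power_mult)
  have "2 powr (- (p - 1) / 2) < 2 powr (0 :: real)" using p by (intro powr_less_mono) auto
  then have q: "norm (2 powr (- (p - 1) / 2)) < 1" by simp
  have "(\<lambda>k. real k * (2 powr (- (p - 1) / 2)) ^ k + (2 powr (- (p - 1) / 2)) ^ k) \<longlonglongrightarrow> 0 + 0"
    using q by (intro tendsto_add powser_times_n_limit_0 LIMSEQ_power_zero) auto
  then have "(\<lambda>k. ((real k + 1) * (2 powr (- (p - 1) / 2)) ^ k)\<^sup>2) \<longlonglongrightarrow> 0\<^sup>2"
    by (intro tendsto_power) (simp add: distrib_right)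
  then have "(\<lambda>k. (real k + 1)\<^sup>2 * 2 powr (- (p - 1) * k)) \<longlonglongrightarrow> 0"
    unfolding eq by simp
  then obtain M where M: "0 < M" "\<And>k. norm ((real k + 1)\<^sup>2 * 2 powr (- (p - 1) * k)) \<le> M"
    by (meson BseqE convergentI convergent_imp_Bseq)
  have main: "(y - x) powr p \<le> 2 powr p * M * (cantor_param y - cantor_param x)"
    if xy: "0 \<le> x" "x < y" "y \<le> 1" for x y
  proof -
    define P where "P k \<longleftrightarrow> 1 / 2 ^ k \<le> y - x" for k :: nat
    obtain k0 where "(1/2) ^ k0 < y - x" using real_arch_pow_inv[of "y - x" "1/2"] xy by auto
    then have "P k0" by (simp add: P_def power_one_over)
    define k where "k = (LEAST k. P k)"
    have k: "P k" unfolding k_def using \<open>P k0\<close> by (rule LeastI)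
    have "y - x \<le> 2 / 2 ^ k"
    proof (cases k)
      case (Suc j)
      then have "\<not> P j" using not_less_Least[of j P] by (simp add: k_def)
      then show ?thesis using Suc by (simp add: P_def)
    qed (use xy in simp)
    then have "(y - x) powr p \<le> (2 / 2 ^ k) powr p" using xy p by (intro powr_mono2) auto
    also have "\<dots> = 2 powr p * ((real k + 1)\<^sup>2 * 2 powr (- (p - 1) * k)) * cantor_coeff k"
    proof -
      have "(2 / 2 ^ k) powr p = 2 powr ((1 - real k) * p)"
      proof -
        have "2 / 2 ^ k = 2 powr (1 - real k)" by (simp add: powr_diff powr_realpow)
        then show ?thesis by (simp add: powr_powr)
      qed
      also have "(1 - real k) * p = p + - (p - 1) * k + - real k" by (simp add: algebra_simps)
      also have "2 powr \<dots> = 2 powr p * 2 powr (- (p - 1) * k) * (1 / 2 ^ k)"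
        unfolding powr_add by (simp add: powr_minus powr_realpow divide_simps)
      finally show ?thesis by (simp add: cantor_coeff_def)
    qed
    also have "\<dots> \<le> 2 powr p * M * cantor_coeff k"
      using M(2)[of k] cantor_coeff_pos[of k] by (intro mult_right_mono mult_left_mono) auto
    also have "\<dots> \<le> 2 powr p * M * (cantor_param y - cantor_param x)"
      using cantor_param_expand[of x y k] k xy M by (intro mult_left_mono) (auto simp: P_def)
    finally show ?thesis .
  qed
  show ?thesis
  proof (intro exI[of _ "2 powr p * M"] conjI ballI)
    fix x y :: real assume "x \<in> {0..1}" "y \<in> {0..1}"
    then show "\<bar>x - y\<bar> powr p \<le> 2 powr p * M * \<bar>cantor_param x - cantor_param y\<bar>"
    proof (induction x y rule: linorder_wlog)
      case (le x y)
      show ?case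
      proof (cases "x = y")
        case False
        then have "(y - x) powr p \<le> 2 powr p * M * (cantor_param y - cantor_param x)"
          using le by (intro main) auto
        also have "\<dots> \<le> 2 powr p * M * \<bar>cantor_param x - cantor_param y\<bar>"
          using M by (intro mult_left_mono) auto
        finally show ?thesis using le by (simp add: abs_minus_commute)
      qed simp
    next
      case (sym x y) then show ?case by (simp add: abs_minus_commute)
    qed
  qed (use M in simp)
qed

text \<open>Divided by \<open>2 ^ N\<close>, it bounds the oscillation of
  \<open>cantor_param\<close> on a dyadic interval of level \<open>N\<close>.\<close>

definition cantor_tail :: "nat \<Rightarrow> real" where
  "cantor_tail N = (\<Sum>k. 1 / (real (k + N) + 1)\<^sup>2)"

text \<open>Moving from \<open>j / 2 ^ N\<close> up to \<open>y\<close> inside one dyadic interval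
  changes no floor of level below \<open>N\<close>, and changes the floor of level
  \<open>k + N\<close> by at most \<open>2 ^ k\<close>. Weighted by \<open>cantor_coeff\<close>,
  these changes are bounded by the tail.\<close>

lemma cantor_param_oscillation:
  assumes y: "0 \<le> y" "y < 1" and N: "j = nat \<lfloor>2 ^ N * y\<rfloor>"
  shows "j < 2 ^ N"
    and "cantor_param y \<in> {cantor_param (j / 2 ^ N) .. cantor_param (j / 2 ^ N) + cantor_tail N / 2 ^ N}"
proof -
  define x where "x = j / 2 ^ N"
  have "\<lfloor>2 ^ N * y\<rfloor> < 2 ^ N" using y by (simp add: floor_less_iff)
  then show "j < 2 ^ N" using N y
    by (metis nat_less_iff of_nat_numeral of_nat_power zero_le_floor mult_nonneg_nonneg zero_le_numeral zero_le_power)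
  have j: "real j = of_int \<lfloor>2 ^ N * y\<rfloor>" using N y by simp
  have xy: "x \<le> y" and yx: "y \<le> x + 1 / 2 ^ N"
    unfolding x_def j by (simp_all add: field_simps) linarith+
  have x: "0 \<le> x" by (simp add: x_def)
  define D where "D k = real_of_int \<lfloor>2 ^ k * y\<rfloor> - of_int \<lfloor>2 ^ k * x\<rfloor>" for k
  have D0: "0 \<le> D k" for k
    using xy by (auto simp: D_def intro!: floor_mono mult_left_mono)
  have s: "(\<lambda>k. cantor_coeff k * D k) sums (cantor_param y - cantor_param x)"
    unfolding D_def using x y xy by (intro cantor_param_diff) auto
  \<comment> \<open>\<open>i / 2 ^ k\<close> is a multiple of \<open>1 / 2 ^ N\<close> not above
    \<open>y\<close>, and \<open>x\<close> is the largest such multiple.\<close>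
  have "D k = 0" if k: "k < N" for k
  proof -
    define i where "i = \<lfloor>2 ^ k * y\<rfloor>"
    have "of_int i \<le> 2 ^ k * y" by (simp add: i_def)
    then have "of_int (i * 2 ^ (N - k)) \<le> 2 ^ k * y * 2 ^ (N - k)" by simp
    also have "\<dots> = 2 ^ N * y" using k by (simp add: power_add[symmetric])
    finally have "i * 2 ^ (N - k) \<le> \<lfloor>2 ^ N * y\<rfloor>" by (simp only: le_floor_iff)
    then have "real_of_int (i * 2 ^ (N - k)) \<le> real j" unfolding j by (simp only: of_int_le_iff)
    also have "real j = 2 ^ k * x * 2 ^ (N - k)" using k by (simp add: x_def power_add[symmetric] mult_ac)
    finally have "of_int i \<le> 2 ^ k * x" by simp
    then have "i \<le> \<lfloor>2 ^ k * x\<rfloor>" by (simp add: le_floor_iff)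
    then show ?thesis using D0[of k] by (simp add: D_def i_def)
  qed
  then have s': "(\<lambda>k. cantor_coeff (k + N) * D (k + N)) sums (cantor_param y - cantor_param x)"
    using sums_split_initial_segment[OF s, of N] by simp
  have b: "cantor_coeff (k + N) * D (k + N) \<le> 1 / (real (k + N) + 1)\<^sup>2 / 2 ^ N" for k
  proof -
    \<comment> \<open>\<open>x\<close> lies on the grid of level \<open>k + N\<close>, so its floor
      is exact and the increment is at most \<open>2 ^ k\<close>, without an extra 1.\<close>
    have "2 ^ (k + N) * x = of_int (2 ^ k * int j)" by (simp add: x_def power_add)
    then have "real_of_int \<lfloor>2 ^ (k + N) * x\<rfloor> = 2 ^ (k + N) * x"
      by (metis floor_of_int)
    moreover have "real_of_int \<lfloor>2 ^ (k + N) * y\<rfloor> \<le> 2 ^ (k + N) * y" by simp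
    moreover have "2 ^ (k + N) * y \<le> 2 ^ (k + N) * (x + 1 / 2 ^ N)" using yx by (intro mult_left_mono) auto
    moreover have "2 ^ (k + N) * (x + 1 / 2 ^ N) = 2 ^ (k + N) * x + 2 ^ k"
      by (simp add: power_add distrib_left)
    ultimately have "D (k + N) \<le> 2 ^ k" unfolding D_def by linarith
    then have "cantor_coeff (k + N) * D (k + N) \<le> cantor_coeff (k + N) * 2 ^ k"
      using cantor_coeff_pos by (intro mult_left_mono) (auto simp: less_imp_le)
    also have "\<dots> = 1 / (real (k + N) + 1)\<^sup>2 / 2 ^ N"
      by (simp add: cantor_coeff_def power_add)
    finally show ?thesis .
  qed
  have t: "(\<lambda>k. 1 / (real (k + N) + 1)\<^sup>2 / 2 ^ N) sums (cantor_tail N / 2 ^ N)"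
    unfolding cantor_tail_def
    using summable_ignore_initial_segment[OF summable_inverse_square_Suc, of N]
    by (intro sums_divide summable_sums)
  have "cantor_param y - cantor_param x \<le> cantor_tail N / 2 ^ N"
    by (rule sums_le[OF b s' t])
  moreover have "0 \<le> cantor_param y - cantor_param x"
    using cantor_coeff_pos D0 by (intro sums_le[OF _ sums_zero s']) (auto simp: less_imp_le)
  ultimately show "cantor_param y \<in> {cantor_param (j / 2 ^ N) .. cantor_param (j / 2 ^ N) + cantor_tail N / 2 ^ N}"
    unfolding x_def[symmetric] by auto
qed

text \<open>A closed set containing the range of \<open>cantor_param\<close> on [0, 1) replaces the
  range itself, so that it is Borel by its form.\<close>

definition cantor_set :: "real set" where
  "cantor_set = (\<Inter>N. \<Union>j\<in>{..<2 ^ N::nat}. {cantor_param (j / 2 ^ N) .. cantor_param (j / 2 ^ N) + cantor_tail N / 2 ^ N})"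

lemma cantor_set_borel [measurable]: "cantor_set \<in> sets borel"
  unfolding cantor_set_def by (intro sets.countable_INT'' sets.finite_UN) auto

lemma bounded_cantor_set: "bounded cantor_set"
  by (rule bounded_subset[OF bounded_closed_interval[of "cantor_param 0" "cantor_param 0 + cantor_tail 0"]])
     (auto simp: cantor_set_def dest!: spec[of _ 0])

lemma cantor_param_in_cantor_set:
  assumes "0 \<le> y" "y < 1"
  shows "cantor_param y \<in> cantor_set"
  unfolding cantor_set_def using cantor_param_oscillation[OF assms refl] by blast

text \<open>The \<open>2 ^ N\<close> intervals of level \<open>N\<close> have total length
  \<open>cantor_tail N\<close>, the tail of a convergent series.\<close>

lemma cantor_set_null: "cantor_set \<in> null_sets lborel"
proof -
  have tail0: "0 \<le> cantor_tail N" for N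
    unfolding cantor_tail_def
    using summable_ignore_initial_segment[OF summable_inverse_square_Suc, of N] by (intro suminf_nonneg) auto
  have "emeasure lborel cantor_set \<le> ennreal (cantor_tail N)" for N
  proof -
    let ?J = "\<lambda>j::nat. {cantor_param (j / 2 ^ N) .. cantor_param (j / 2 ^ N) + cantor_tail N / 2 ^ N}"
    have "emeasure lborel cantor_set \<le> emeasure lborel (\<Union>j\<in>{..<2 ^ N}. ?J j)"
      by (intro emeasure_mono) (auto simp: cantor_set_def)
    also have "\<dots> \<le> (\<Sum>j<2 ^ N. emeasure lborel (?J j))"
      by (intro emeasure_subadditive_finite) auto
    also have "\<dots> = (\<Sum>j<(2 ^ N::nat). ennreal (cantor_tail N / 2 ^ N))"
      using tail0 by simp
    also have "\<dots> = ennreal (2 ^ N * (cantor_tail N / 2 ^ N))"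
      by (simp add: sum_ennreal tail0 del: times_divide_eq_right sum_constant) simp
    finally show ?thesis by simp
  qed
  moreover have "(\<lambda>N. ennreal (cantor_tail N)) \<longlonglongrightarrow> 0"
  proof -
    have "cantor_tail \<longlonglongrightarrow> 0"
      unfolding cantor_tail_def by (rule suminf_exist_split2[OF summable_inverse_square_Suc])
    then show ?thesis by (metis ennreal_0 tendsto_ennrealI)
  qed
  ultimately have "emeasure lborel cantor_set \<le> 0"
    by (intro tendsto_lowerbound) auto
  then show ?thesis by (auto simp: null_sets_def)
qed

section \<open>The parameter set\<close>

text \<open>
  Averaging the translates \<open>N - w v\<close> over \<open>w \<in> [0, 1]\<close> replaces a choice of coordinates adapted to \<open>v\<close>.
\<close>

lemma null_sets_lborel_if_lines_null:
  fixes N :: "'a::euclidean_space set" and v :: 'a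
  assumes N: "N \<in> sets borel" and null: "\<And>y. {w::real. y + w *\<^sub>R v \<in> N} \<in> null_sets lborel"
  shows "N \<in> null_sets lborel"
proof -
  have [measurable]: "N \<in> sets borel" by fact
  have m: "(\<lambda>(w::real, y). indicator N (y + w *\<^sub>R v) :: ennreal) \<in> borel_measurable (lborel \<Otimes>\<^sub>M lborel)"
    by measurable
  have tr: "(\<integral>\<^sup>+y. indicator N (y + w *\<^sub>R v) \<partial>lborel) = emeasure lborel N" for w :: real
  proof -
    have "emeasure lborel N = emeasure (distr lborel borel ((+) (w *\<^sub>R v))) N"
      by (simp add: lborel_distr_plus)
    also have "\<dots> = (\<integral>\<^sup>+y. indicator N (w *\<^sub>R v + y) \<partial>lborel)"
      using N by (subst nn_integral_indicator[symmetric], simp) (subst nn_integral_distr, auto)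
    finally show ?thesis by (simp add: add.commute)
  qed
  have "(\<integral>\<^sup>+w. emeasure lborel N * indicator {0..1} w \<partial>(lborel::real measure)) \<le> (\<integral>\<^sup>+w. emeasure lborel N \<partial>(lborel::real measure))"
    by (intro nn_integral_mono) (auto simp: indicator_def)
  also have "(\<integral>\<^sup>+w. emeasure lborel N \<partial>(lborel::real measure))
      = (\<integral>\<^sup>+w. (\<integral>\<^sup>+y. indicator N (y + w *\<^sub>R v) \<partial>lborel) \<partial>(lborel::real measure))"
    by (simp only: tr)
  also have "\<dots> = (\<integral>\<^sup>+y. (\<integral>\<^sup>+w. indicator N (y + w *\<^sub>R v) \<partial>(lborel::real measure)) \<partial>lborel)"
    using lborel_pair.Fubini'[OF m] by simp
  also have "\<dots> = (\<integral>\<^sup>+y. 0 \<partial>(lborel :: 'a measure))"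
  proof (rule nn_integral_cong)
    fix y
    have "(\<integral>\<^sup>+w. indicator N (y + w *\<^sub>R v) \<partial>(lborel::real measure)) = (\<integral>\<^sup>+w. indicator {w. y + w *\<^sub>R v \<in> N} w \<partial>lborel)"
      by (intro nn_integral_cong) (auto simp: indicator_def)
    also have "\<dots> = 0" using null[of y] by (auto simp: null_sets_def)
    finally show "(\<integral>\<^sup>+w. indicator N (y + w *\<^sub>R v) \<partial>(lborel::real measure)) = 0" .
  qed
  finally have "emeasure lborel N = 0" by (simp add: nn_integral_cmult)
  then show ?thesis using N by (auto simp: null_sets_def)
qed

text \<open>\<open>h\<close> is applied to all of \<open>t\<close>, but the Lipschitz condition
  imposed on it below makes it independent of \<open>t $ l\<close>, so \<open>t $ l = h t\<close> is
  an explicit equation. The range \<open>{1/4..1/2}\<close> keeps the free dilations inside the open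
  unit cube and away from 0.\<close>

definition curve_parameters :: "'d::finite \<Rightarrow> 'd \<Rightarrow> 'm::finite \<Rightarrow> (real^'m \<Rightarrow> real) \<Rightarrow> ((real^'d) \<times> (real^'m)) set" where
  "curve_parameters i j l h =
     {(x, t). x $ i \<in> cantor_set \<and> x $ j = 0 \<and> (\<forall>k. k \<noteq> i \<and> k \<noteq> j \<longrightarrow> x $ k \<in> {1/4..1/2}) \<and>
        t $ l = h t \<and> (\<forall>k. k \<noteq> l \<longrightarrow> t $ k \<in> {1/4..1/2})}"

text \<open>The coordinates that determine a point of \<open>curve_parameters i j l h\<close>.\<close>

definition free_coords :: "'d::finite \<Rightarrow> 'm::finite \<Rightarrow> ((real^'d) \<times> (real^'m)) set" where
  "free_coords j l = Basis - {(axis j 1, 0), (0, axis l 1)}"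

lemma Basis_vec_prod:
  "(Basis :: ((real^'d::finite) \<times> (real^'m::finite)) set) = range (\<lambda>k. (axis k 1, 0)) \<union> range (\<lambda>k. (0, axis k 1))"
  by (auto simp: Basis_prod_def Basis_vec_def)

lemma card_free_coords:
  "card (free_coords j l :: ((real^'d::finite) \<times> (real^'m::finite)) set) = CARD('d) + CARD('m) - 2"
proof -
  have ne: "(axis j 1 :: real^'d, 0 :: real^'m) \<noteq> (0, axis l 1)"
    by (auto simp: axis_eq_0_iff)
  have "card (free_coords j l :: ((real^'d) \<times> (real^'m)) set)
      = card (Basis :: ((real^'d) \<times> (real^'m)) set) - card {(axis j 1 :: real^'d, 0 :: real^'m), (0, axis l 1)}"
    unfolding free_coords_def by (rule card_Diff_subset) (auto simp: Basis_vec_prod)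
  then show ?thesis using ne by simp
qed

lemma free_coords_iff:
  "c \<in> free_coords j l \<longleftrightarrow> (\<exists>k. k \<noteq> j \<and> c = (axis k 1, 0)) \<or> (\<exists>k. k \<noteq> l \<and> c = (0, axis k 1))"
  by (auto simp: free_coords_def Basis_vec_prod axis_eq_axis axis_eq_0_iff)

text \<open>Upper bound: \<open>x $ j\<close> is constant and \<open>t $ l\<close> is Lipschitz in
  the other dilations, so the free coordinates control distances. Lower bound: a box maps into the
  set by applying \<open>cantor_param\<close> to \<open>x $ i\<close>, and each free coordinate is
  recovered with every Hoelder exponent below one.\<close>

lemma hausdorff_dim_curve_parameters:
  fixes h :: "real^'m::finite \<Rightarrow> real" and i j :: "'d::finite"
  assumes ij: "i \<noteq> j" and K: "0 \<le> K"
    and lip: "\<And>t t' r. (\<And>k. k \<noteq> l \<Longrightarrow> t $ k \<in> {1/4..1/2} \<and> t' $ k \<in> {1/4..1/2} \<and> \<bar>t $ k - t' $ k\<bar> \<le> r) \<Longrightarrow> 0 \<le> r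
                \<Longrightarrow> \<bar>h t - h t'\<bar> \<le> K * r"
    and bdd: "\<And>t. (\<And>k. k \<noteq> l \<Longrightarrow> t $ k \<in> {1/4..1/2}) \<Longrightarrow> h t \<in> {0..1}"
  shows "hausdorff_dim (curve_parameters i j l h) = ereal (real CARD('d) + real CARD('m) - 2)"
proof -
  let ?F = "curve_parameters i j l h"
  let ?B = "free_coords j l :: ((real^'d) \<times> (real^'m)) set"
  have B: "?B \<subseteq> Basis" by (auto simp: free_coords_def)
  have "CARD('d) \<ge> 2" using ij card_mono[of UNIV "{i, j}"] by simp
  moreover have "CARD('m) \<ge> 1" by (simp add: Suc_leI)
  ultimately have n: "real CARD('d) + real CARD('m) - 2 = real (card ?B)"
    unfolding card_free_coords by linarith
  show ?thesis unfolding n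
  proof (rule hausdorff_dim_eqI)
    fix s :: real assume "card ?B < s"
    show "hausdorff_measure s ?F = 0"
    proof (rule hausdorff_measure_eq_0[OF B \<open>card ?B < s\<close>])
      obtain R where R: "\<And>z. z \<in> cantor_set \<Longrightarrow> \<bar>z\<bar> \<le> R"
        using bounded_cantor_set unfolding bounded_iff by auto
      have "\<forall>u\<in>?F. \<forall>c\<in>Basis. \<bar>u \<bullet> c\<bar> \<le> \<bar>R\<bar> + 1"
      proof (intro ballI)
        fix u c :: "(real^'d) \<times> (real^'m)" assume u: "u \<in> ?F" and c: "c \<in> Basis"
        obtain x t where xt: "u = (x, t)" by (cases u)
        have "t $ l \<in> {0..1}" using u bdd[of t] by (auto simp: curve_parameters_def xt)
        then have "\<bar>t $ k\<bar> \<le> \<bar>R\<bar> + 1" for k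
          using u by (cases "k = l") (force simp: curve_parameters_def xt)+
        moreover have "\<bar>x $ k\<bar> \<le> \<bar>R\<bar> + 1" for k
          using u R[of "x $ i"] by (cases "k = i"; cases "k = j") (force simp: curve_parameters_def xt)+
        ultimately show "\<bar>u \<bullet> c\<bar> \<le> \<bar>R\<bar> + 1" using c
          by (auto simp: Basis_vec_prod xt inner_axis)
      qed
      then have "norm u \<le> real DIM((real^'d) \<times> (real^'m)) * (\<bar>R\<bar> + 1)" if "u \<in> ?F" for u
        using that by (intro order_trans[OF norm_le_l1] sum_bounded_above) auto
      then show "bounded ?F" by (rule boundedI)
      show "0 \<le> real DIM((real^'d) \<times> (real^'m)) * (K + 1)" using K by simp
      fix u v :: "(real^'d) \<times> (real^'m)" and r :: real
      assume u: "u \<in> ?F" and v: "v \<in> ?F" and r: "0 \<le> r"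
        and c: "\<And>c. c \<in> ?B \<Longrightarrow> \<bar>(u - v) \<bullet> c\<bar> \<le> r"
      obtain x t where xt: "u = (x, t)" by (cases u)
      obtain y w where yw: "v = (y, w)" by (cases v)
      have 1: "\<bar>x $ k - y $ k\<bar> \<le> r" if "k \<noteq> j" for k
        using c[of "(axis k 1, 0)"] that by (auto simp: free_coords_iff xt yw inner_axis)
      have 2: "\<bar>t $ k - w $ k\<bar> \<le> r" if "k \<noteq> l" for k
        using c[of "(0, axis k 1)"] that by (auto simp: free_coords_iff xt yw inner_axis)
      have "\<bar>h t - h w\<bar> \<le> K * r"
        using u v r 2 by (intro lip) (auto simp: curve_parameters_def xt yw)
      then have 3: "\<bar>t $ l - w $ l\<bar> \<le> K * r" using u v by (auto simp: curve_parameters_def xt yw)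
      have 4: "x $ j = y $ j" using u v by (auto simp: curve_parameters_def xt yw)
      \<comment> \<open>\<open>K + 1\<close> serves both the free coordinates, which vary by
        \<open>r\<close>, and \<open>t $ l\<close>, which varies by \<open>K * r\<close>.\<close>
      have r': "r \<le> (K + 1) * r" "K * r \<le> (K + 1) * r" using K r by (simp_all add: distrib_right)
      have "\<bar>(u - v) \<bullet> c\<bar> \<le> (K + 1) * r" if "c \<in> Basis" for c
      proof -
        have "\<bar>x $ k - y $ k\<bar> \<le> (K + 1) * r" for k
          using 1[of k] 4 r' r by (cases "k = j") auto
        moreover have "\<bar>t $ k - w $ k\<bar> \<le> (K + 1) * r" for k
          using 2[of k] 3 r' r by (cases "k = l") auto
        ultimately show ?thesis using that by (auto simp: Basis_vec_prod xt yw inner_axis)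
      qed
      then have "(\<Sum>c\<in>Basis. \<bar>(u - v) \<bullet> c\<bar>) \<le> real DIM((real^'d) \<times> (real^'m)) * ((K + 1) * r)"
        by (rule sum_bounded_above)
      then show "dist u v \<le> real DIM((real^'d) \<times> (real^'m)) * (K + 1) * r"
        using norm_le_l1[of "u - v"] by (simp only: dist_norm mult.assoc)
    qed
  next
    fix s :: real assume s: "0 \<le> s" "s < card ?B"
    \<comment> \<open>The box is full-dimensional; \<open>\<phi>\<close> overwrites
      \<open>x $ j\<close> and \<open>t $ l\<close>, the two directions outside
      \<open>free_coords j l\<close>.\<close>
    define \<phi> where "\<phi> = (\<lambda>(x, t). (\<chi> k. if k = i then cantor_param (x $ i) else if k = j then 0 else x $ k,
                                  \<chi> k. if k = l then h t else t $ k) :: (real^'d) \<times> (real^'m))"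
    let ?a = "(1/4) *\<^sub>R One :: (real^'d) \<times> (real^'m)" and ?b = "(1/2) *\<^sub>R One :: (real^'d) \<times> (real^'m)"
    have cb: "(x, t) \<in> cbox ?a ?b \<longleftrightarrow> (\<forall>k. x $ k \<in> {1/4..1/2}) \<and> (\<forall>k. t $ k \<in> {1/4..1/2})" for x t
    proof -
      have *: "(x, t) \<in> cbox ?a ?b \<longleftrightarrow> (\<forall>c\<in>Basis. 1/4 \<le> (x, t) \<bullet> c \<and> (x, t) \<bullet> c \<le> 1/2)"
        unfolding mem_box by (intro ball_cong) auto
      show ?thesis unfolding * by (simp add: Basis_vec_prod ball_Un inner_axis)
    qed
    show "hausdorff_measure s ?F \<noteq> 0"
    proof (rule hausdorff_measure_pos[OF B s])
      show "box ?a ?b \<noteq> {}" by (simp add: box_ne_empty)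
      show "\<phi> ` cbox ?a ?b \<subseteq> ?F"
      proof (rule image_subsetI)
        fix u assume u: "u \<in> cbox ?a ?b"
        obtain x t where xt: "u = (x, t)" by (cases u)
        have "(x, t) \<in> cbox ?a ?b" using u by (simp only: xt)
        then have x: "\<And>k. x $ k \<in> {1/4..1/2}" and t: "\<And>k. t $ k \<in> {1/4..1/2}" by (simp_all only: cb)
        define t' where "t' = (\<chi> k. if k = l then h t else t $ k)"
        \<comment> \<open>Radius 0 in \<open>lip\<close> says that \<open>h\<close> ignores
          \<open>t $ l\<close>, so overwriting this coordinate by \<open>h t\<close> does satisfy
          the constraint.\<close>
        have "\<bar>h t' - h t\<bar> \<le> K * 0" using t by (intro lip) (auto simp: t'_def)
        then have "h t' = h t" by simp
        moreover have "cantor_param (x $ i) \<in> cantor_set"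
          using x[of i] by (intro cantor_param_in_cantor_set) auto
        ultimately show "\<phi> u \<in> ?F"
          using x t ij unfolding xt \<phi>_def curve_parameters_def case_prod_conv t'_def[symmetric]
          by (auto simp: t'_def)
      qed
      fix p :: real assume p: "1 < p"
      then obtain K where K: "0 < K" and h: "\<And>x y. x \<in> {0..1} \<Longrightarrow> y \<in> {0..1} \<Longrightarrow>
          \<bar>x - y\<bar> powr p \<le> K * \<bar>cantor_param x - cantor_param y\<bar>"
        using cantor_param_holder by blast
      \<comment> \<open>Coordinates copied by \<open>\<phi>\<close> differ by at most 1, so the
        power \<open>p > 1\<close> only decreases the difference. The constant \<open>K + 1\<close>
        fits these and the Cantor coordinate alike.\<close>
      have pw: "\<bar>z\<bar> powr p \<le> (K + 1) * \<bar>z\<bar>" if "\<bar>z\<bar> \<le> 1" for z :: real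
      proof (cases "z = 0")
        case False
        have "\<bar>z\<bar> powr p \<le> \<bar>z\<bar> powr 1" using p that False by (intro powr_mono') auto
        also have "\<dots> \<le> (K + 1) * \<bar>z\<bar>" using K by (simp add: distrib_right)
        finally show ?thesis .
      qed simp
      show "\<exists>K>0. \<forall>u\<in>cbox ?a ?b. \<forall>v\<in>cbox ?a ?b. \<forall>c\<in>?B. \<bar>(u - v) \<bullet> c\<bar> powr p \<le> K * dist (\<phi> u) (\<phi> v)"
      proof (intro exI[of _ "K + 1"] conjI ballI)
        fix u v c assume u: "u \<in> cbox ?a ?b" and v: "v \<in> cbox ?a ?b" and c: "c \<in> ?B"
        obtain x t where xt: "u = (x, t)" by (cases u)
        obtain y w where yw: "v = (y, w)" by (cases v)
        have x: "x $ k \<in> {1/4..1/2}" and t: "t $ k' \<in> {1/4..1/2}"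
          and y: "y $ k \<in> {1/4..1/2}" and w: "w $ k' \<in> {1/4..1/2}" for k k'
          using u v unfolding xt yw cb by blast+
        have "\<bar>(u - v) \<bullet> c\<bar> powr p \<le> (K + 1) * \<bar>(\<phi> u - \<phi> v) \<bullet> c\<bar>"
        proof -
          consider k where "k \<noteq> j" "c = (axis k 1, 0)" | k where "k \<noteq> l" "c = (0, axis k 1)"
            using c unfolding free_coords_iff by blast
          then show ?thesis
          proof cases
            case 1
            show ?thesis
            proof (cases "k = i")
              case True
              have "\<bar>x $ i - y $ i\<bar> powr p \<le> K * \<bar>cantor_param (x $ i) - cantor_param (y $ i)\<bar>"
                using x[of i] y[of i] by (intro h) auto
              also have "\<dots> \<le> (K + 1) * \<bar>cantor_param (x $ i) - cantor_param (y $ i)\<bar>"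
                by (intro mult_right_mono) auto
              finally show ?thesis using 1 True by (simp add: xt yw \<phi>_def inner_axis)
            next
              case False
              then show ?thesis using 1 x[of k] y[of k] pw[of "x $ k - y $ k"]
                by (simp add: xt yw \<phi>_def inner_axis abs_le_iff)
            qed
          next
            case 2
            then show ?thesis using t[of k] w[of k] pw[of "t $ k - w $ k"]
              by (simp add: xt yw \<phi>_def inner_axis abs_le_iff)
          qed
        qed
        also have "\<dots> \<le> (K + 1) * dist (\<phi> u) (\<phi> v)"
          unfolding dist_norm using K c B by (intro mult_left_mono Basis_le_norm) auto
        finally show "\<bar>(u - v) \<bullet> c\<bar> powr p \<le> (K + 1) * dist (\<phi> u) (\<phi> v)" .
      qed (use K in simp)
    qed
  qed simp
qed

section \<open>Measurability of the parameter set and nullity of the union of curves\<close>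

lemma curve_parameters_borel:
  assumes [measurable]: "h \<in> borel_measurable borel"
  shows "(curve_parameters i j l h :: ((real^'d::finite) \<times> (real^'m::finite)) set) \<in> sets borel"
proof -
  have [measurable]: "(\<lambda>x. x $ k) \<in> borel_measurable (borel :: (real^'n::finite) measure)" for k
    by (intro borel_measurable_continuous_onI continuous_intros)
  have "{z \<in> space (borel \<Otimes>\<^sub>M borel). fst z $ i \<in> cantor_set \<and> fst z $ j = 0 \<and>
          (\<forall>k\<in>UNIV. k \<noteq> i \<and> k \<noteq> j \<longrightarrow> fst z $ k \<in> {1/4..1/2}) \<and> snd z $ l = h (snd z) \<and>
          (\<forall>k\<in>UNIV. k \<noteq> l \<longrightarrow> snd z $ k \<in> {1/4..1/2})}
        \<in> sets ((borel :: (real^'d) measure) \<Otimes>\<^sub>M (borel :: (real^'m) measure))"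
    by measurable
  then show ?thesis
    by (simp add: curve_parameters_def borel_prod[symmetric] space_pair_measure case_prod_beta')
qed

text \<open>As \<open>x $ j = 0\<close>, the relation \<open>q\<close> gives
  \<open>y $ i - q (y $ j) = x $ i\<close> at every point \<open>y\<close> of the union. The set
  \<open>N\<close> of all \<open>y\<close> for which this difference lies in
  \<open>cantor_set\<close> meets lines in direction \<open>i\<close> in null sets.\<close>

lemma curve_union_curve_parameters_null:
  fixes \<omega> :: "'d::finite \<Rightarrow> 'm::finite"
  assumes ij: "i \<noteq> j" and [measurable]: "q \<in> borel_measurable borel"
    and q: "\<And>x t s. (x, t) \<in> curve_parameters i j l h \<Longrightarrow> s \<in> I \<Longrightarrow> t $ \<omega> i * \<gamma> s $ i = q (t $ \<omega> j * \<gamma> s $ j)"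
  shows "curve_union \<omega> \<gamma> I (curve_parameters i j l h) \<in> null_sets lebesgue"
proof -
  define N where "N = {y :: real^'d. y $ i - q (y $ j) \<in> cantor_set}"
  have [measurable]: "(\<lambda>x. x $ k) \<in> borel_measurable (borel :: (real^'d) measure)" for k
    by (intro borel_measurable_continuous_onI continuous_intros)
  have "N \<in> null_sets lborel"
  proof (rule null_sets_lborel_if_lines_null[where v = "axis i 1"])
    show "N \<in> sets borel" unfolding N_def by measurable
    fix y :: "real^'d"
    \<comment> \<open>Since \<open>i \<noteq> j\<close>, moving along axis \<open>i\<close> fixes
      \<open>y $ j\<close>, so the section is a translate of \<open>cantor_set\<close>.\<close>
    have "{w. y + w *\<^sub>R axis i 1 \<in> N} = (\<lambda>w. y $ i - q (y $ j) + w) -` cantor_set \<inter> space lborel"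
      using ij by (auto simp: N_def axis_def algebra_simps)
    also have "\<dots> \<in> null_sets lborel"
    proof -
      have "cantor_set \<in> null_sets (distr lborel borel ((+) (y $ i - q (y $ j))))"
        using cantor_set_null by (simp add: lborel_distr_plus)
      then show ?thesis by (subst (asm) null_sets_distr_iff) auto
    qed
    finally show "{w. y + w *\<^sub>R axis i 1 \<in> N} \<in> null_sets lborel" .
  qed
  then have N: "N \<in> null_sets lebesgue" by (rule null_sets_completionI)
  have "curve_union \<omega> \<gamma> I (curve_parameters i j l h) \<subseteq> N"
  proof
    fix y assume "y \<in> curve_union \<omega> \<gamma> I (curve_parameters i j l h)"
    then obtain x t s where xt: "(x, t) \<in> curve_parameters i j l h" and s: "s \<in> I"
      and y: "y = x + dilated_curve \<omega> \<gamma> t s"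
      by (auto simp: curve_union_def)
    have "x $ i \<in> cantor_set" "x $ j = 0" using xt by (auto simp: curve_parameters_def)
    then show "y \<in> N" by (simp add: N_def y dilated_curve_def q[OF xt s])
  qed
  with N show ?thesis by (metis negligible_iff_null_sets negligible_subset)
qed

text \<open>Reduces the theorem to finding a constraint \<open>h\<close> on one dilation under which
  all dilated arcs project into the graph of a single function \<open>q\<close>.\<close>

lemma curve_parameters_witness:
  fixes \<omega> :: "'d::finite \<Rightarrow> 'm::finite"
  assumes "i \<noteq> j" and "h \<in> borel_measurable borel" and "q \<in> borel_measurable borel"
    and lip: "\<exists>K\<ge>0. \<forall>t t' r. 0 \<le> r \<longrightarrow> (\<forall>k. k \<noteq> l \<longrightarrow> t $ k \<in> {1/4..1/2} \<and> t' $ k \<in> {1/4..1/2} \<and> \<bar>t $ k - t' $ k\<bar> \<le> r)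
                \<longrightarrow> \<bar>h t - h t'\<bar> \<le> K * r"
    and bdd: "\<And>t. (\<And>k. k \<noteq> l \<Longrightarrow> t $ k \<in> {1/4..1/2}) \<Longrightarrow> 0 < h t \<and> h t < 1"
    and q: "\<And>t s. (\<And>k. k \<noteq> l \<Longrightarrow> t $ k \<in> {1/4..1/2}) \<Longrightarrow> t $ l = h t \<Longrightarrow> s \<in> I
                \<Longrightarrow> t $ \<omega> i * \<gamma> s $ i = q (t $ \<omega> j * \<gamma> s $ j)"
  shows "\<exists>F' :: ((real ^ 'd) \<times> (real ^ 'm)) set.
           F' \<in> sets borel \<and> F' \<subseteq> UNIV \<times> open_unit_cube \<and>
           hausdorff_dim F' = ereal (real CARD('d) + real CARD('m) - 2) \<and>
           curve_union \<omega> \<gamma> I F' \<in> null_sets lebesgue"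
proof (intro exI conjI)
  let ?F = "curve_parameters i j l h :: ((real ^ 'd) \<times> (real ^ 'm)) set"
  show "?F \<in> sets borel" by (rule curve_parameters_borel) fact
  show "?F \<subseteq> UNIV \<times> open_unit_cube"
  proof (clarsimp simp: open_unit_cube_def)
    fix x t k assume F: "(x, t) \<in> ?F"
    show "0 < t $ k \<and> t $ k < 1"
    proof (cases "k = l")
      case True then show ?thesis using F bdd[of t] by (simp add: curve_parameters_def)
    next
      case False
      then have "t $ k \<in> {1/4..1/2}" using F by (auto simp: curve_parameters_def)
      then show ?thesis by auto
    qed
  qed
  obtain K where K: "0 \<le> K" "\<And>t t' r. 0 \<le> r \<Longrightarrow> (\<And>k. k \<noteq> l \<Longrightarrow> t $ k \<in> {1/4..1/2} \<and> t' $ k \<in> {1/4..1/2} \<and> \<bar>t $ k - t' $ k\<bar> \<le> r)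
                \<Longrightarrow> \<bar>h t - h t'\<bar> \<le> K * r" using lip by blast
  show "hausdorff_dim ?F = ereal (real CARD('d) + real CARD('m) - 2)"
  proof (rule hausdorff_dim_curve_parameters[OF \<open>i \<noteq> j\<close> K(1)])
    show "h t \<in> {0..1}" if "\<And>k. k \<noteq> l \<Longrightarrow> t $ k \<in> {1/4..1/2}" for t
      using bdd[OF that] by auto
  qed (use K(2) in blast)
  show "curve_union \<omega> \<gamma> I ?F \<in> null_sets lebesgue"
    by (rule curve_union_curve_parameters_null[OF \<open>i \<noteq> j\<close> assms(3)], rule q)
       (auto simp: curve_parameters_def)
qed

section \<open>The choice of the constraint and of the fixed curve\<close>

lemma lipschitz_powr:
  assumes "1 \<le> (p::real)" "x \<in> {1/4..1/2}" "y \<in> {1/4..1/2}"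
  shows "\<bar>x powr p - y powr p\<bar> \<le> p * \<bar>x - y\<bar>"
proof -
  have "norm (x powr p - y powr p) \<le> p * norm (x - y)"
  proof (rule field_differentiable_bound)
    show "((\<lambda>x. x powr p) has_field_derivative p * z powr (p - 1)) (at z within {1/4..1/2})"
      if "z \<in> {1/4..1/2}" for z
      using that by (auto intro!: derivative_eq_intros)
    show "norm (p * z powr (p - 1)) \<le> p" if "z \<in> {1/4..1/2}" for z
      using that assms(1) by (auto simp: abs_mult intro!: mult_left_le powr_le1)
  qed (use assms in auto)
  then show ?thesis by simp
qed

theorem proposition4p1:
  fixes \<omega> :: "'d::{finite, linorder} \<Rightarrow> 'm::finite"
    and a :: "'d \<Rightarrow> nat"
    and \<gamma> :: "real \<Rightarrow> real ^ 'd::{finite, linorder}"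
    and I :: "real set"
  assumes "2 \<le> CARD('d)"
    and "1 \<le> CARD('m)" and "CARD('m) \<le> CARD('d)"
    and "surj \<omega>"
    and "\<And>i. 1 \<le> a i" and "strict_mono a"
    and "\<And>s. s \<in> {0..1} \<Longrightarrow> \<gamma> s = (\<chi> i. s ^ a i)"
    and "is_interval I" and "compact (closure I)" and "closure I \<subseteq> {0..1}"
    and "0 < measure lborel I"
  shows "\<exists>F' :: ((real ^ 'd::{finite, linorder}) \<times> (real ^ 'm)) set.
           F' \<in> sets borel \<and> F' \<subseteq> UNIV \<times> open_unit_cube \<and>
           hausdorff_dim F' = ereal (real CARD('d) + real CARD('m) - 2) \<and>
           curve_union \<omega> \<gamma> I F' \<in> null_sets lebesgue"
proof -
  have I: "0 \<le> s" "\<gamma> s $ i = s ^ a i" if "s \<in> I" for s i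
    using assms(7)[of s] that assms(10) closure_subset[of I] by (auto simp: subset_iff)
  \<comment> \<open>For \<open>s \<ge> 0\<close>, \<open>s ^ a i\<close> is a function of
    \<open>s ^ a j\<close>; at \<open>s = 0\<close> both sides vanish because the exponents are
    positive.\<close>
  have root: "(s ^ a j) powr (a i / a j) = s ^ a i" if "0 \<le> s" for s i j
  proof (cases "s = 0")
    case True
    then show ?thesis using assms(5)[of i] assms(5)[of j] by (simp add: zero_power)
  next
    case False
    then show ?thesis using that assms(5)[of j] by (simp add: powr_realpow[symmetric] powr_powr)
  qed
  show ?thesis
  proof (cases "inj \<omega>")
    case False
    then obtain i j where ij: "i \<noteq> j" "\<omega> i = \<omega> j" by (auto simp: inj_def)
    show ?thesis
    \<comment> \<open>Both coordinates carry the dilation \<open>t $ \<omega> j\<close>, frozen at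
      1/2: in \<open>q\<close> the factor 2 undoes it before the root and the outer 1/2 restores
      it.\<close>
    proof (rule curve_parameters_witness[OF ij(1), of "\<lambda>_. 1/2" "\<lambda>z. 1/2 * (2 * z) powr (a i / a j)" "\<omega> j"])
      fix t :: "real^'m" and s assume "t $ \<omega> j = 1/2" "s \<in> I"
      then show "t $ \<omega> i * \<gamma> s $ i = 1/2 * (2 * (t $ \<omega> j * \<gamma> s $ j)) powr (a i / a j)"
      proof -
        have e: "2 * (t $ \<omega> j * \<gamma> s $ j) = s ^ a j"
          using I[OF \<open>s \<in> I\<close>] \<open>t $ \<omega> j = 1/2\<close> by simp
        have "t $ \<omega> i = 1/2" using ij \<open>t $ \<omega> j = 1/2\<close> by simp
        then show ?thesis
          unfolding e by (simp only: root[OF I(1)[OF \<open>s \<in> I\<close>]] I(2)[OF \<open>s \<in> I\<close>])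
      qed
    qed (auto intro!: exI[of _ "0::real"])
  next
    case True
    \<comment> \<open>The order \<open>i < j\<close> makes the exponent \<open>a j / a i\<close>
      exceed 1, as \<open>lipschitz_powr\<close> requires.\<close>
    obtain i j :: 'd where ij: "i < j"
      using assms(1) by (metis (full_types) UNIV_I card_2_iff' card_le_Suc0_iff_eq finite linorder_neqE not_less_eq_eq numeral_2_eq_2)
    then have \<omega>: "\<omega> i \<noteq> \<omega> j" using True by (auto simp: inj_def)
    have "a i < a j" using ij assms(6) by (simp add: strict_mono_def)
    then have p: "1 < a j / a i" using assms(5)[of i] by (simp add: field_simps)
    have [measurable]: "(\<lambda>t. t $ k) \<in> borel_measurable (borel :: (real^'m) measure)" for k
      by (intro borel_measurable_continuous_onI continuous_intros)
    show ?thesis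
    \<comment> \<open>Eliminating \<open>r\<close> from \<open>t $ \<omega> i = r ^ a i\<close> and
      \<open>t $ \<omega> j = r ^ a j\<close> gives \<open>h\<close>. Both arc coordinates are then
      powers of \<open>r * s\<close>, which \<open>q\<close> relates.\<close>
    proof (rule curve_parameters_witness[of i j "\<lambda>t. (t $ \<omega> i) powr (a j / a i)" "\<lambda>z. z powr (a i / a j)" "\<omega> j"])
      show "\<exists>K\<ge>0. \<forall>t t' r. 0 \<le> r \<longrightarrow>
          (\<forall>k. k \<noteq> \<omega> j \<longrightarrow> t $ k \<in> {1/4..1/2} \<and> t' $ k \<in> {1/4..1/2} \<and> \<bar>t $ k - t' $ k\<bar> \<le> r) \<longrightarrow>
          \<bar>(t $ \<omega> i) powr (a j / a i) - (t' $ \<omega> i) powr (a j / a i)\<bar> \<le> K * r"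
      proof (intro exI[of _ "a j / a i"] conjI allI impI)
        fix t t' :: "real^'m" and r :: real
        assume "\<forall>k. k \<noteq> \<omega> j \<longrightarrow> t $ k \<in> {1/4..1/2} \<and> t' $ k \<in> {1/4..1/2} \<and> \<bar>t $ k - t' $ k\<bar> \<le> r"
        then have t: "t $ \<omega> i \<in> {1/4..1/2}" "t' $ \<omega> i \<in> {1/4..1/2}" "\<bar>t $ \<omega> i - t' $ \<omega> i\<bar> \<le> r" using \<omega> by auto
        have "\<bar>(t $ \<omega> i) powr (a j / a i) - (t' $ \<omega> i) powr (a j / a i)\<bar> \<le> a j / a i * \<bar>t $ \<omega> i - t' $ \<omega> i\<bar>"
          using p t by (intro lipschitz_powr) auto
        also have "\<dots> \<le> a j / a i * r" using t by (intro mult_left_mono) auto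
        finally show "\<bar>(t $ \<omega> i) powr (a j / a i) - (t' $ \<omega> i) powr (a j / a i)\<bar> \<le> a j / a i * r" .
      qed auto
      fix t :: "real^'m" assume t: "\<And>k. k \<noteq> \<omega> j \<Longrightarrow> t $ k \<in> {1/4..1/2}"
      have ti: "t $ \<omega> i \<in> {1/4..1/2}" using t \<omega> by auto
      have "(t $ \<omega> i) powr (a j / a i) < 1 powr (a j / a i)"
        using ti p by (intro powr_less_mono2) auto
      then show "0 < (t $ \<omega> i) powr (a j / a i) \<and> (t $ \<omega> i) powr (a j / a i) < 1" using ti by auto
      fix s assume tj: "t $ \<omega> j = (t $ \<omega> i) powr (a j / a i)" and s: "s \<in> I"
      have "((t $ \<omega> i) powr (a j / a i)) powr (a i / a j) = t $ \<omega> i"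
        using ti assms(5)[of i] assms(5)[of j] by (simp add: powr_powr)
      then show "t $ \<omega> i * \<gamma> s $ i = (t $ \<omega> j * \<gamma> s $ j) powr (a i / a j)"
        using I[OF s] ti root[of s j i] by (simp add: tj powr_mult)
    qed (use ij in auto)
  qed
qed

end
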